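(* Let $R$ be an associative ring (not necessarily unital). For $i=1,2$ let $a_i,b_i,c_i\in R$ and suppose that $a_i$ is annihilator $(b_i,c_i)$-invertible with annihilator $(b_i,c_i)$-inverse $x_i\in R$. Then for any $y\in R^1$ the following are equivalent: (1) $yx_1=x_2y$; (2) $c_2ya_1b_1=c_2a_2yb_1$, $yb_1\in x_2R$, and $c_2y\in Rx_1$; (3) $c_2ya_1b_1=c_2a_2yb_1$, $yb_1=x_2a_2yb_1$, and $c_2y=c_2ya_1x_1$.
   Context: For $u\in R$ write ${}^{\circ}u=\{r\in R: ru=0\}$, $u^{\circ}=\{r\in R: ur=0\}$, $uR=\{ur:r\in R\}$, $Ru=\{ru:r\in R\}$. For $a,b,c\in R$, an element $x\in R$ is an annihilator $(b,c)$-inverse of $a$ if $xax=x$, $xab=b$, $cax=c$, ${}^{\circ}b\subseteq{}^{\circ}x$, and $c^{\circ}\subseteq x^{\circ}$; such $x$ is unique when it exists, and $a$ is then called annihilator $(b,c)$-invertible. $R^1$ denotes the multiplicative monoid equal to $R$ if $R$ has an identity element and to $R\cup\{1\}$ (with an identity $1$ adjoined) otherwise. *)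

theory Defs
  imports Main
begin

text \<open>The class \<^class>\<open>ring\<close> is that of associative rings, not necessarily unital or commutative.\<close>

definition left_ann :: "'a::ring \<Rightarrow> 'a set" where
  "left_ann u = {r. r * u = 0}"

definition right_ann :: "'a::ring \<Rightarrow> 'a set" where
  "right_ann u = {r. u * r = 0}"

definition right_mults :: "'a::ring \<Rightarrow> 'a set" where
  "right_mults u = {u * r | r. True}"

definition left_mults :: "'a::ring \<Rightarrow> 'a set" where
  "left_mults u = {r * u | r. True}"

definition is_ann_inverse :: "'a::ring \<Rightarrow> 'a \<Rightarrow> 'a \<Rightarrow> 'a \<Rightarrow> bool" where
  "is_ann_inverse a b c x \<longleftrightarrow>
     x * a * x = x \<and> x * a * b = b \<and> c * a * x = c \<and>
     left_ann b \<subseteq> left_ann x \<and> right_ann c \<subseteq> right_ann x"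

definition is_identity :: "'a::ring \<Rightarrow> bool" where
  "is_identity e \<longleftrightarrow> (\<forall>r. e * r = r \<and> r * e = r)"

lemma is_identity_unique: "is_identity e \<Longrightarrow> is_identity f \<Longrightarrow> e = f"
  unfolding is_identity_def by metis

text \<open>The monoid \<open>R\<^sup>1\<close>: \<open>None\<close> stands for the adjoined identity, and is present only if
  the ring has no identity element of its own. So \<open>R\<^sup>1\<close> is \<open>R\<close> itself in the unital case.\<close>

typedef (overloaded) 'a R1 = "{z :: 'a::ring option. z = None \<longrightarrow> \<not> (\<exists>e::'a. is_identity e)}"
  by (rule exI[of _ "Some 0"]) simp

definition incl :: "'a::ring \<Rightarrow> 'a R1" where
  "incl r = Abs_R1 (Some r)"

fun option_times :: "'a::ring option \<Rightarrow> 'a option \<Rightarrow> 'a option" where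
  "option_times None z = z"
| "option_times (Some r) None = Some r"
| "option_times (Some r) (Some s) = Some (r * s)"

lemma option_times_None_right [simp]: "option_times z None = z"
  by (cases z) simp_all

lemma option_times_assoc:
  "option_times (option_times u v) w = option_times u (option_times v w)"
  by (cases u; cases v; cases w) (simp_all add: mult.assoc)

lemma option_times_closed:
  assumes "u = None \<longrightarrow> P" "v = None \<longrightarrow> P"
  shows "option_times u v = None \<longrightarrow> P"
  using assms by (cases u; cases v) simp_all

instantiation R1 :: (ring) monoid_mult
begin

definition one_R1 :: "'a R1" where
  "one_R1 = (if \<exists>e::'a. is_identity e then incl (THE e. is_identity e) else Abs_R1 None)"

definition times_R1 :: "'a R1 \<Rightarrow> 'a R1 \<Rightarrow> 'a R1" where
  "times_R1 y z = Abs_R1 (option_times (Rep_R1 y) (Rep_R1 z))"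

lemma Rep_R1_times: "Rep_R1 (y * z) = option_times (Rep_R1 y) (Rep_R1 z)"
  for y z :: "'a R1"
  unfolding times_R1_def
  by (rule Abs_R1_inverse, rule CollectI, rule option_times_closed)
    (use Rep_R1[of y] Rep_R1[of z] in simp_all)

lemma Rep_R1_incl: "Rep_R1 (incl r) = Some r" for r :: 'a
  by (simp add: incl_def Abs_R1_inverse)

lemma option_times_one:
  fixes y :: "'a R1"
  shows "option_times (Rep_R1 1) (Rep_R1 y) = Rep_R1 y"
    and "option_times (Rep_R1 y) (Rep_R1 1) = Rep_R1 y"
proof -
  have "option_times (Rep_R1 1) (Rep_R1 y) = Rep_R1 y \<and>
        option_times (Rep_R1 y) (Rep_R1 1) = Rep_R1 y"
  proof (cases "\<exists>e::'a. is_identity e")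
    case True
    then obtain e :: 'a where e: "is_identity e" by blast
    then have "(THE e. is_identity e) = e"
      using is_identity_unique by blast
    with True have one: "Rep_R1 (1 :: 'a R1) = Some e"
      by (simp add: one_R1_def Rep_R1_incl)
    from True Rep_R1[of y] obtain r where "Rep_R1 y = Some r"
      by (cases "Rep_R1 y") auto
    with one e show ?thesis by (simp add: is_identity_def)
  next
    case False
    then show ?thesis by (simp add: one_R1_def Abs_R1_inverse)
  qed
  then show "option_times (Rep_R1 1) (Rep_R1 y) = Rep_R1 y"
    and "option_times (Rep_R1 y) (Rep_R1 1) = Rep_R1 y" by simp_all
qed

instance
proof
  fix u v w :: "'a R1"
  show "u * v * w = u * (v * w)"
    by (simp add: Rep_R1_inject[symmetric] Rep_R1_times option_times_assoc)
  show "1 * u = u" "u * 1 = u"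
    by (simp_all add: Rep_R1_inject[symmetric] Rep_R1_times option_times_one)
qed

end

lemma incl_mult: "incl (r * s) = incl r * incl s"
  by (simp add: Rep_R1_inject[symmetric] Rep_R1_times Rep_R1_incl)

lemma inj_incl: "inj incl"
  by (rule injI) (metis Rep_R1_incl option.inject)

lemma R1_cases_incl: "(\<exists>r. y = incl r) \<or> (y = 1 \<and> \<not> (\<exists>e::'a. is_identity e))"
  for y :: "'a::ring R1"
proof (cases "Rep_R1 y")
  case None
  then have "\<not> (\<exists>e::'a. is_identity e)" using Rep_R1[of y] by simp
  moreover from this None have "y = 1"
    by (simp add: one_R1_def Rep_R1_inject[symmetric] Abs_R1_inverse)
  ultimately show ?thesis by blast
next
  case (Some r)
  then have "y = incl r" by (simp add: Rep_R1_inject[symmetric] Rep_R1_incl)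
  then show ?thesis by blast
qed

lemma range_incl_unital: "\<exists>e::'a::ring. is_identity e \<Longrightarrow> range incl = (UNIV :: 'a R1 set)"
  using R1_cases_incl by blast

lemma one_notin_range_incl:
  assumes "\<not> (\<exists>e::'a::ring. is_identity e)"
  shows "(1 :: 'a R1) \<notin> range incl"
proof
  assume "(1 :: 'a R1) \<in> range incl"
  then obtain e :: 'a where e: "1 = incl e" by blast
  have "e * r = r \<and> r * e = r" for r
    using inj_incl by (metis e incl_mult injD mult_1_left mult_1_right)
  then show False using assms unfolding is_identity_def by blast
qed

end

theory Submission imports Defs begin

text \<open>
  All three conditions say that \<open>y\<close> intertwines \<open>x\<^sub>1\<close> and \<open>x\<^sub>2\<close>. The equations \<open>x a b = b\<close> and
  \<open>c a x = c\<close> let one move from \<open>x\<^sub>1, x\<^sub>2\<close> to \<open>b\<^sub>1, c\<^sub>2\<close>, and the two annihilator inclusions let one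
  move back: in a product, a right factor \<open>b\<close> may be replaced by \<open>x\<close>, and so may a left factor \<open>c\<close>,
  without destroying an equation.

  The interesting implication is the return to \<open>y x\<^sub>1 = x\<^sub>2 y\<close>. Replacing \<open>c\<^sub>2\<close> and \<open>b\<^sub>1\<close> in
  \<open>c\<^sub>2 y a\<^sub>1 b\<^sub>1 = c\<^sub>2 a\<^sub>2 y b\<^sub>1\<close> gives \<open>x\<^sub>2 y a\<^sub>1 x\<^sub>1 = x\<^sub>2 a\<^sub>2 y x\<^sub>1\<close>. It remains to recognise the two
  sides as \<open>x\<^sub>2 y\<close> and \<open>y x\<^sub>1\<close>. The obvious idea is to replace \<open>b\<^sub>1\<close> by \<open>x\<^sub>1\<close> in
  \<open>y b\<^sub>1 = x\<^sub>2 a\<^sub>2 y b\<^sub>1\<close>. But annihilators consist of elements of \<open>R\<close>, whereas \<open>y\<close> may be the adjoined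
  identity, so \<open>y - x\<^sub>2 a\<^sub>2 y\<close> need not make sense. The remedy is to write \<open>y b\<^sub>1 = (y x\<^sub>1 a\<^sub>1) b\<^sub>1\<close>: the
  element \<open>y x\<^sub>1 a\<^sub>1\<close> lies in \<open>R\<close>, because \<open>R\<close> is an ideal of \<open>R\<^sup>1\<close>, and
  \<open>y x\<^sub>1 a\<^sub>1 x\<^sub>1 = y x\<^sub>1\<close>. The other side is symmetric.
\<close>

lemma mult_incl_in_range: "y * incl r \<in> range incl"
  using R1_cases_incl[of y] by (metis incl_mult mult_1_left rangeI)

lemma incl_mult_in_range: "incl r * y \<in> range incl"
  using R1_cases_incl[of y] by (metis incl_mult mult_1_right rangeI)

text \<open>The annihilator inclusions as replacement rules. The elements \<open>u\<close> and \<open>v\<close> must come from \<open>R\<close>,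
  since the proofs apply the inclusion to their difference.\<close>

lemma replace_right_factor:
  assumes "left_ann b \<subseteq> left_ann x" "u \<in> range incl" "v \<in> range incl"
    and "u * incl b = v * incl b"
  shows "u * incl x = v * incl x"
proof -
  obtain r s where rs: "u = incl r" "v = incl s" using assms(2,3) by blast
  then have "r * b = s * b" using assms(4) by (metis incl_mult inj_incl injD)
  then have "r - s \<in> left_ann b" by (simp add: left_ann_def left_diff_distrib)
  then have "r - s \<in> left_ann x" using assms(1) by blast
  then have "r * x = s * x" by (simp add: left_ann_def left_diff_distrib)
  then show ?thesis by (metis rs incl_mult)
qed

lemma replace_left_factor:
  assumes "right_ann c \<subseteq> right_ann x" "u \<in> range incl" "v \<in> range incl"
    and "incl c * u = incl c * v"
  shows "incl x * u = incl x * v"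
proof -
  obtain r s where rs: "u = incl r" "v = incl s" using assms(2,3) by blast
  then have "c * r = c * s" using assms(4) by (metis incl_mult inj_incl injD)
  then have "r - s \<in> right_ann c" by (simp add: right_ann_def right_diff_distrib)
  then have "r - s \<in> right_ann x" using assms(1) by blast
  then have "x * r = x * s" by (simp add: right_ann_def right_diff_distrib)
  then show ?thesis by (metis rs incl_mult)
qed

text \<open>The defining equations read in \<open>R\<^sup>1\<close>, each also in the form that rewrites inside a longer
  right-nested product.\<close>

lemma ann_inverse_incl:
  assumes "is_ann_inverse a b c x"
  shows "incl x * (incl a * incl x) = incl x"
    and "incl x * (incl a * incl b) = incl b"
    and "incl c * (incl a * incl x) = incl c"
    and "incl x * (incl a * (incl x * z)) = incl x * z"
    and "incl c * (incl a * (incl x * z)) = incl c * z"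
  using assms unfolding is_ann_inverse_def by (metis incl_mult mult.assoc)+

lemma mem_right_mults_iff_fixed:
  assumes "is_ann_inverse a b c x"
  shows "y * incl d \<in> incl ` right_mults x \<longleftrightarrow> y * incl d = incl x * incl a * y * incl d"
proof
  assume "y * incl d \<in> incl ` right_mults x"
  then obtain r where "y * incl d = incl x * incl r"
    by (auto simp: right_mults_def incl_mult)
  then show "y * incl d = incl x * incl a * y * incl d"
    by (simp add: mult.assoc ann_inverse_incl[OF assms])
next
  assume fixed: "y * incl d = incl x * incl a * y * incl d"
  obtain r where "y * incl d = incl r" using mult_incl_in_range by blast
  with fixed have "y * incl d = incl (x * (a * r))"
    by (simp add: mult.assoc incl_mult)
  then show "y * incl d \<in> incl ` right_mults x"
    by (auto simp: right_mults_def)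
qed

lemma mem_left_mults_iff_fixed:
  assumes "is_ann_inverse a b c x"
  shows "incl d * y \<in> incl ` left_mults x \<longleftrightarrow> incl d * y = incl d * y * incl a * incl x"
proof
  assume "incl d * y \<in> incl ` left_mults x"
  then obtain r where "incl d * y = incl r * incl x"
    by (auto simp: left_mults_def incl_mult)
  then show "incl d * y = incl d * y * incl a * incl x"
    by (simp add: mult.assoc ann_inverse_incl[OF assms])
next
  assume fixed: "incl d * y = incl d * y * incl a * incl x"
  obtain r where "incl d * y = incl r" using incl_mult_in_range by blast
  with fixed have "incl d * y = incl (r * a * x)"
    by (simp add: incl_mult)
  then show "incl d * y \<in> incl ` left_mults x"
    by (auto simp: left_mults_def)
qed

lemma intertwines_imp_equations:
  assumes inv1: "is_ann_inverse a1 b1 c1 x1" and inv2: "is_ann_inverse a2 b2 c2 x2"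
    and eq: "y * incl x1 = incl x2 * y"
  shows "incl c2 * y * incl a1 * incl b1 = incl c2 * incl a2 * y * incl b1"
    and "y * incl b1 = incl x2 * incl a2 * y * incl b1"
    and "incl c2 * y = incl c2 * y * incl a1 * incl x1"
proof -
  note I = ann_inverse_incl[OF inv1] ann_inverse_incl[OF inv2]
  have eq': "incl x2 * (y * z) = y * (incl x1 * z)" for z
    using eq by (metis mult.assoc)
  \<comment> \<open>Both \<open>y b\<^sub>1\<close> and \<open>c\<^sub>2 y\<close> acquire a factor \<open>x\<^sub>i\<close>, which then moves across \<open>y\<close>.\<close>
  have yb: "y * incl b1 = incl x2 * (y * (incl a1 * incl b1))"
    by (simp add: eq' I)
  have cy: "incl c2 * y = incl c2 * (incl a2 * (y * incl x1))"
    by (simp add: eq I)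
  show "incl c2 * y * incl a1 * incl b1 = incl c2 * incl a2 * y * incl b1"
    by (simp add: mult.assoc yb I)
  show "y * incl b1 = incl x2 * incl a2 * y * incl b1"
    by (simp add: mult.assoc yb I)
  have "incl c2 * y * incl a1 * incl x1
      = incl c2 * (incl a2 * (y * (incl x1 * (incl a1 * incl x1))))"
    by (simp add: cy mult.assoc)
  also have "\<dots> = incl c2 * y" by (simp only: I cy)
  finally show "incl c2 * y = incl c2 * y * incl a1 * incl x1" ..
qed

lemma equations_imp_intertwines:
  assumes inv1: "is_ann_inverse a1 b1 c1 x1" and inv2: "is_ann_inverse a2 b2 c2 x2"
    and mid: "incl c2 * y * incl a1 * incl b1 = incl c2 * incl a2 * y * incl b1"
    and yb: "y * incl b1 = incl x2 * incl a2 * y * incl b1"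
    and cy: "incl c2 * y = incl c2 * y * incl a1 * incl x1"
  shows "y * incl x1 = incl x2 * y"
proof -
  note I = ann_inverse_incl[OF inv1] ann_inverse_incl[OF inv2]
  have b1: "left_ann b1 \<subseteq> left_ann x1" and c2: "right_ann c2 \<subseteq> right_ann x2"
    using inv1 inv2 by (simp_all add: is_ann_inverse_def)
  note in_R = mult_incl_in_range incl_mult_in_range

  have "(y * incl x1 * incl a1) * incl b1 = (incl x2 * (incl a2 * y)) * incl b1"
    using yb by (simp add: mult.assoc I)
  from replace_right_factor[OF b1 in_R this]
  have yx: "y * incl x1 = incl x2 * (incl a2 * (y * incl x1))"
    by (simp add: mult.assoc I)

  have "incl c2 * (incl a2 * (incl x2 * y)) = incl c2 * ((y * incl a1) * incl x1)"
    using cy by (simp add: mult.assoc I)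
  from replace_left_factor[OF c2 in_R(2,1) this]
  have xy: "incl x2 * y = incl x2 * (y * (incl a1 * incl x1))"
    by (simp add: mult.assoc I)

  have "(incl c2 * (y * incl a1)) * incl b1 = (incl c2 * (incl a2 * y)) * incl b1"
    using mid by (simp add: mult.assoc)
  from replace_right_factor[OF b1 in_R(2,2) this]
  have "incl c2 * ((y * incl a1) * incl x1) = incl c2 * ((incl a2 * y) * incl x1)"
    by (simp add: mult.assoc)
  from replace_left_factor[OF c2 in_R(1,1) this]
  have "incl x2 * (y * (incl a1 * incl x1)) = incl x2 * (incl a2 * (y * incl x1))"
    by (simp add: mult.assoc)
  with yx xy show ?thesis by simp
qed

theorem theorem3p2:
  fixes a1 b1 c1 x1 a2 b2 c2 x2 :: "'a::ring"
    and y :: "'a R1"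
  assumes "is_ann_inverse a1 b1 c1 x1"
    and "is_ann_inverse a2 b2 c2 x2"
  shows "(y * incl x1 = incl x2 * y
           \<longleftrightarrow> incl c2 * y * incl a1 * incl b1 = incl c2 * incl a2 * y * incl b1
             \<and> y * incl b1 \<in> incl ` right_mults x2
             \<and> incl c2 * y \<in> incl ` left_mults x1)
       \<and> (y * incl x1 = incl x2 * y
           \<longleftrightarrow> incl c2 * y * incl a1 * incl b1 = incl c2 * incl a2 * y * incl b1
             \<and> y * incl b1 = incl x2 * incl a2 * y * incl b1
             \<and> incl c2 * y = incl c2 * y * incl a1 * incl x1)"
proof -
  let ?P = "y * incl x1 = incl x2 * y"
  let ?mid = "incl c2 * y * incl a1 * incl b1 = incl c2 * incl a2 * y * incl b1"
  let ?yb = "y * incl b1 = incl x2 * incl a2 * y * incl b1"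
  let ?cy = "incl c2 * y = incl c2 * y * incl a1 * incl x1"
  have "?P \<longleftrightarrow> ?mid \<and> ?yb \<and> ?cy"
    using intertwines_imp_equations[OF assms, of y] equations_imp_intertwines[OF assms, of y]
    by blast
  then show ?thesis
    unfolding mem_right_mults_iff_fixed[OF assms(2)] mem_left_mults_iff_fixed[OF assms(1)]
    by blast
qed

end
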